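(* Let $G$ be a finite simple undirected graph with at least one vertex, whose vertex set is equipped with a total order. Then the prune-and-choose procedure $\textsc{FindMatchings}(G,\emptyset)$ (defined in the context) terminates, and the set of edge sets that it returns is exactly the set of all perfect matchings of $G$. (In particular, it returns the empty set if $G$ has no perfect matching.)
   Context: A perfect matching of a graph $G$ is a set of edges of $G$ such that every vertex of $G$ is an endpoint of exactly one edge in the set. For vertices $u,v$ of $G$, $G\setminus\{u,v\}$ denotes the subgraph of $G$ induced on the vertices other than $u$ and $v$, with the inherited vertex order. "First" vertex with a property means the smallest such vertex in the given total order. The recursive procedure $\textsc{FindMatchings}(G,M)$ takes as input a graph $G$ (with ordered vertices) and a set $M$ of already matched edges, and returns a set of edge sets, according to the first of the following cases that applies: 1. If $G$ is connected and has exactly two vertices $u,v$, return the single edge set $M\cup\{(u,v)\}$, i.e. return $\{M\cup\{(u,v)\}\}$. 2. Else, if $G$ has a vertex with exactly one neighbor (prune step): let $u$ be the first degree-one vertex and let $v$ be its unique neighbor; return $\textsc{FindMatchings}(G\setminus\{u,v\},\,M\cup\{(u,v)\})$. 3. Else, if some connected component of $G$ has an odd number of vertices: stop this branch and return $\emptyset$ (no matchings). 4. Else (choose step): let $u$ be the first vertex among those with the minimum number of neighbors, and let $v_1,\dots,v_k$ be its neighbors; return $\bigcup_{i=1}^k \textsc{FindMatchings}(G\setminus\{u,v_i\},\,M\cup\{(u,v_i)\})$. *)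

theory Defs
  imports Main
begin

text \<open>
  A graph is given by its vertex set \<open>V\<close> and its edge set \<open>E\<close>, an undirected edge between
  \<open>u\<close> and \<open>v\<close> being the set \<open>{u, v}\<close>. The vertex order is that of the type class
  \<^class>\<open>linorder\<close>, so that subgraphs inherit it.
\<close>

definition simple_graph :: "'a set \<Rightarrow> 'a set set \<Rightarrow> bool" where
  "simple_graph V E \<longleftrightarrow> finite V \<and> (\<forall>e\<in>E. e \<subseteq> V \<and> card e = 2)"

definition neighbors :: "'a set set \<Rightarrow> 'a \<Rightarrow> 'a set" where
  "neighbors E u = {v. {u, v} \<in> E}"

definition degree :: "'a set set \<Rightarrow> 'a \<Rightarrow> nat" where
  "degree E u = card (neighbors E u)"

definition induced_edges :: "'a set set \<Rightarrow> 'a set \<Rightarrow> 'a set set" where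
  "induced_edges E W = {e \<in> E. e \<subseteq> W}"

definition reachable :: "'a set set \<Rightarrow> 'a \<Rightarrow> 'a \<Rightarrow> bool" where
  "reachable E = (\<lambda>x y. {x, y} \<in> E)\<^sup>*\<^sup>*"

definition connected_graph :: "'a set \<Rightarrow> 'a set set \<Rightarrow> bool" where
  "connected_graph V E \<longleftrightarrow> V \<noteq> {} \<and> (\<forall>u\<in>V. \<forall>v\<in>V. reachable E u v)"

definition components :: "'a set \<Rightarrow> 'a set set \<Rightarrow> 'a set set" where
  "components V E = (\<lambda>u. {v \<in> V. reachable E u v}) ` V"

definition perfect_matching :: "'a set \<Rightarrow> 'a set set \<Rightarrow> 'a set set \<Rightarrow> bool" where
  "perfect_matching V E P \<longleftrightarrow> P \<subseteq> E \<and> (\<forall>v\<in>V. \<exists>!e. e \<in> P \<and> v \<in> e)"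

definition first_degree_one :: "'a::linorder set \<Rightarrow> 'a set set \<Rightarrow> 'a" where
  "first_degree_one V E = Min {u \<in> V. degree E u = 1}"

definition first_min_degree :: "'a::linorder set \<Rightarrow> 'a set set \<Rightarrow> 'a" where
  "first_min_degree V E = Min {u \<in> V. \<forall>w\<in>V. degree E u \<le> degree E w}"

text \<open>
  In the first case \<open>V\<close> consists of two vertices \<open>u\<close> and \<open>v\<close>, so the edge \<open>{u, v}\<close>
  is \<open>V\<close> itself. No termination proof is given here: the domain predicate
  \<open>find_matchings_dom\<close> holds of exactly those inputs from which there is no infinite chain
  of recursive calls.
\<close>

function (domintros) find_matchings ::
  "'a::linorder set \<Rightarrow> 'a set set \<Rightarrow> 'a set set \<Rightarrow> 'a set set set" where
  "find_matchings V E M =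
    (if connected_graph V E \<and> card V = 2 then {M \<union> {V}}
     else if \<exists>u\<in>V. degree E u = 1 then
       (let u = first_degree_one V E; v = the_elem (neighbors E u); W = V - {u, v}
        in find_matchings W (induced_edges E W) (M \<union> {{u, v}}))
     else if \<exists>C\<in>components V E. odd (card C) then {}
     else
       (let u = first_min_degree V E
        in \<Union>v\<in>neighbors E u.
             find_matchings (V - {u, v}) (induced_edges E (V - {u, v})) (M \<union> {{u, v}})))"
  by pat_completeness auto

end

theory Submission
  imports Defs
begin

text \<open>
  Every perfect matching contains exactly one edge at a given vertex \<open>u\<close>, and deleting that edge
  leaves a perfect matching of the graph without its two endpoints. So both recursive steps are
  instances of one branching over the partners of \<open>u\<close>, whatever the choice of \<open>u\<close>, and an odd
  component rules out a perfect matching. The vertex set never becomes empty, since an edge that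
  exhausts it is caught by the first case; this matters because on the empty graph
  \<open>first_min_degree\<close> is the minimum of an empty set.
\<close>

lemma neighbors_subset: "simple_graph V E \<Longrightarrow> neighbors E u \<subseteq> V - {u}"
  by (fastforce simp: simple_graph_def neighbors_def)

lemma simple_graph_induced:
  "simple_graph V E \<Longrightarrow> simple_graph (V - A) (induced_edges E (V - A))"
  by (auto simp: simple_graph_def induced_edges_def)

text \<open>Another edge of \<open>P\<close> containing \<open>u\<close> or \<open>v\<close> would
  be a second edge of \<open>P\<close> at that vertex, so all remaining edges lie in
  \<open>V - {u, v}\<close>. Each remaining vertex keeps its edge, since that edge is not
  \<open>{u, v}\<close>.\<close>

lemma perfect_matching_remove:
  assumes "simple_graph V E" "perfect_matching V E P" "{u, v} \<in> P"
  shows "perfect_matching (V - {u, v}) (induced_edges E (V - {u, v})) (P - {{u, v}})"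
proof -
  have sub: "P \<subseteq> E" and uv: "u \<in> V" "v \<in> V"
    and unique: "\<And>x e f. x \<in> V \<Longrightarrow> e \<in> P \<Longrightarrow> f \<in> P \<Longrightarrow> x \<in> e \<Longrightarrow> x \<in> f \<Longrightarrow> e = f"
    using assms unfolding perfect_matching_def simple_graph_def by blast+
  have "P - {{u, v}} \<subseteq> induced_edges E (V - {u, v})"
  proof
    fix e assume "e \<in> P - {{u, v}}"
    then have "e \<in> P" "e \<noteq> {u, v}" by auto
    moreover have "u \<notin> e" "v \<notin> e"
      using unique[OF uv(1) _ assms(3)] unique[OF uv(2) _ assms(3)] calculation by auto
    moreover have "e \<subseteq> V" using \<open>e \<in> P\<close> sub assms(1) by (auto simp: simple_graph_def)
    ultimately show "e \<in> induced_edges E (V - {u, v})"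
      using sub by (auto simp: induced_edges_def)
  qed
  moreover have "\<exists>!e. e \<in> P - {{u, v}} \<and> x \<in> e" if "x \<in> V - {u, v}" for x
  proof -
    obtain e where "e \<in> P" "x \<in> e"
      using assms(2) \<open>x \<in> V - {u, v}\<close> by (auto simp: perfect_matching_def)
    moreover have "f = e" if "f \<in> P" "x \<in> f" for f
      using unique[of x f e] that \<open>e \<in> P\<close> \<open>x \<in> e\<close> \<open>x \<in> V - {u, v}\<close> by simp
    moreover have "e \<noteq> {u, v}" using \<open>x \<in> e\<close> \<open>x \<in> V - {u, v}\<close> by auto
    ultimately show ?thesis by (intro ex1I[of _ e]) blast+
  qed
  ultimately show ?thesis by (simp add: perfect_matching_def)
qed

text \<open>The edges of \<open>Q\<close> avoid \<open>u\<close> and \<open>v\<close>, so the new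
  edge is the only one at these two vertices and changes nothing at the others.\<close>

lemma perfect_matching_insert:
  assumes "{u, v} \<in> E" "perfect_matching (V - {u, v}) (induced_edges E (V - {u, v})) Q"
  shows "perfect_matching V E (insert {u, v} Q)"
proof -
  have sub: "\<And>e. e \<in> Q \<Longrightarrow> e \<in> E \<and> e \<subseteq> V - {u, v}"
    and ex1: "\<And>x. x \<in> V - {u, v} \<Longrightarrow> \<exists>!e. e \<in> Q \<and> x \<in> e"
    using assms(2) by (auto simp: perfect_matching_def induced_edges_def)
  have "\<exists>!e. e \<in> insert {u, v} Q \<and> x \<in> e" if "x \<in> V" for x
  proof (cases "x \<in> {u, v}")
    case True
    with sub show ?thesis by (intro ex1I[of _ "{u, v}"]) blast+
  next
    case False
    then have "e \<in> insert {u, v} Q \<and> x \<in> e \<longleftrightarrow> e \<in> Q \<and> x \<in> e" for e by auto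
    with ex1[of x] False \<open>x \<in> V\<close> show ?thesis by simp
  qed
  with assms(1) sub show ?thesis by (auto simp: perfect_matching_def)
qed

text \<open>The edge of \<open>P\<close> at \<open>u\<close> is \<open>{u, v}\<close> for some
  neighbor \<open>v\<close>; removing it and putting it back gives the two inclusions. The union
  mirrors the choose step, and it has a single term in the prune step.\<close>

lemma perfect_matchings_by_partner:
  assumes "simple_graph V E" "u \<in> V"
  shows "{P. perfect_matching V E P} =
    (\<Union>v\<in>neighbors E u.
      insert {u, v} ` {Q. perfect_matching (V - {u, v}) (induced_edges E (V - {u, v})) Q})"
    (is "_ = ?R")
proof (intro set_eqI iffI)
  fix P assume "P \<in> {P. perfect_matching V E P}"
  then have P: "perfect_matching V E P" by simp
  then obtain e where e: "e \<in> P" "u \<in> e"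
    using assms(2) by (auto simp: perfect_matching_def)
  then have "e \<in> E" "card e = 2" using P assms(1)
    by (auto simp: perfect_matching_def simple_graph_def)
  then obtain v where v: "e = {u, v}" using e(2) by (auto simp: card_2_iff)
  have "P = insert {u, v} (P - {{u, v}})" using e v by auto
  with perfect_matching_remove[OF assms(1) P, of u v] show "P \<in> ?R"
    using e v \<open>e \<in> E\<close> unfolding neighbors_def by blast
next
  fix P assume "P \<in> ?R"
  then show "P \<in> {P. perfect_matching V E P}"
    using perfect_matching_insert by (fastforce simp: neighbors_def)
qed

text \<open>The edges of \<open>P\<close> that meet \<open>C\<close> stay inside \<open>C\<close>,
  cover it and are pairwise disjoint, so they partition \<open>C\<close> into pairs.\<close>

lemma even_component_of_perfect_matching:
  assumes "simple_graph V E" "perfect_matching V E P" "C \<in> components V E"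
  shows "even (card C)"
proof -
  obtain r where C: "C = {v \<in> V. reachable E r v}"
    using assms(3) by (auto simp: components_def)
  have edge: "e \<in> E" "e \<subseteq> V" "card e = 2" if "e \<in> P" for e
    using assms(1,2) \<open>e \<in> P\<close> by (auto simp: perfect_matching_def simple_graph_def)
  let ?F = "{e \<in> P. e \<inter> C \<noteq> {}}"
  have closed: "e \<subseteq> C" if "e \<in> ?F" for e
  proof -
    obtain x y where e: "e = {x, y}" using edge[of e] \<open>e \<in> ?F\<close> by (auto simp: card_2_iff)
    \<comment> \<open>Both orientations are recorded because either endpoint may be the one known to
      lie in \<open>C\<close>; a path from \<open>r\<close> to it extends by one step to the
      other.\<close>
    have "{x, y} \<in> E" "{y, x} \<in> E" "{x, y} \<subseteq> V"
      using edge[of e] \<open>e \<in> ?F\<close> e by (auto simp: insert_commute)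
    then show ?thesis using \<open>e \<in> ?F\<close> e
      by (auto simp: C reachable_def intro: rtranclp.rtrancl_into_rtrancl)
  qed
  have "C \<subseteq> \<Union>?F"
    using assms(2) by (fastforce simp: C perfect_matching_def)
  with closed have "\<Union>?F = C" by blast
  moreover have "2 dvd card (\<Union>?F)"
  proof (rule dvd_partition)
    show "finite (\<Union>?F)"
      using \<open>\<Union>?F = C\<close> C assms(1) by (simp add: simple_graph_def)
    show "\<forall>e\<in>?F. 2 dvd card e" using edge by auto
    show "\<forall>e\<in>?F. \<forall>f\<in>?F. e \<noteq> f \<longrightarrow> e \<inter> f = {}"
    proof (intro ballI impI)
      fix e f assume "e \<in> ?F" "f \<in> ?F" "e \<noteq> f"
      then show "e \<inter> f = {}" using assms(2) edge(2)
        unfolding perfect_matching_def by blast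
    qed
  qed
  ultimately show ?thesis by simp
qed

text \<open>Used to show that an edge whose removal would exhaust the vertex set is already handled
  by the first case.\<close>

lemma connected_pair: "{u, v} \<in> E \<Longrightarrow> connected_graph {u, v} E"
  by (auto simp: connected_graph_def reachable_def insert_commute)

text \<open>On two vertices the only possible edge is \<open>V\<close> itself, and connectedness
  forces it to be present: a path between distinct vertices has a first edge.\<close>

lemma perfect_matching_pair:
  assumes "simple_graph V E" "connected_graph V E" "card V = 2"
  shows "perfect_matching V E P \<longleftrightarrow> P = {V}"
proof -
  have edge: "e = V" if "e \<in> E" for e
    using assms(1,3) \<open>e \<in> E\<close> card_subset_eq[of V e] by (auto simp: simple_graph_def)
  obtain u v where V: "V = {u, v}" "u \<noteq> v" using assms(3) by (auto simp: card_2_iff)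
  then have "reachable E u v" using assms(2) by (auto simp: connected_graph_def)
  then obtain w where "{u, w} \<in> E"
    using \<open>u \<noteq> v\<close> unfolding reachable_def by (auto elim: converse_rtranclpE)
  with edge have "E = {V}" by blast
  with V show ?thesis by (auto simp: perfect_matching_def)
qed

theorem theorem1:
  fixes V :: "'a::linorder set" and E :: "'a set set"
  assumes "simple_graph V E" and "V \<noteq> {}"
  shows "find_matchings_dom (V, E, {}) \<and>
         find_matchings V E {} = {P. perfect_matching V E P}"
proof -
  \<comment> \<open>Recursive calls enlarge the accumulator, so the claim is generalized to
    arbitrary \<open>M\<close>, which is then joined to every perfect matching of the current
    graph.\<close>
  have "find_matchings_dom (V, E, M) \<and>
      find_matchings V E M = (\<union>) M ` {P. perfect_matching V E P}" for M
    using assms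
  proof (induction "card V" arbitrary: V E M rule: less_induct)
    case less
    note graph = \<open>simple_graph V E\<close>
    have fin: "finite V" using graph by (simp add: simple_graph_def)
    let ?call = "\<lambda>u v. (V - {u, v}, induced_edges E (V - {u, v}), insert {u, v} M)"
    let ?result = "\<lambda>u v. find_matchings (V - {u, v}) (induced_edges E (V - {u, v})) (insert {u, v} M)"
    let ?rest = "\<lambda>u v. {Q. perfect_matching (V - {u, v}) (induced_edges E (V - {u, v})) Q}"
    \<comment> \<open>Stated for any vertex \<open>u\<close> and any neighbor \<open>v\<close>, so
      that it serves the prune and the choose step alike.\<close>
    have IH: "find_matchings_dom (?call u v)" "?result u v = (\<union>) M ` insert {u, v} ` ?rest u v"
      if "\<not> (connected_graph V E \<and> card V = 2)" "u \<in> V" "v \<in> neighbors E u" for u v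
    proof -
      have v: "v \<in> V" "u \<noteq> v" "{u, v} \<in> E"
        using neighbors_subset[OF graph] that(3) by (auto simp: neighbors_def)
      \<comment> \<open>Otherwise the edge \<open>{u, v}\<close> would make the graph a connected
        pair, against the failure of the first case. The induction hypothesis demands a nonempty
        remainder.\<close>
      have "V \<noteq> {u, v}"
        using connected_pair[OF v(3)] that(1) v(2) by auto
      then have "V - {u, v} \<noteq> {}" using \<open>u \<in> V\<close> v by auto
      moreover have "card (V - {u, v}) < card V"
        using fin \<open>u \<in> V\<close> by (intro psubset_card_mono) auto
      ultimately have "find_matchings_dom (?call u v) \<and>
          ?result u v = (\<union>) (insert {u, v} M) ` ?rest u v"
        by (intro less.hyps simple_graph_induced graph)
      \<comment> \<open>The matched edge moves from the accumulator into the matching: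
        \<open>insert e M \<union> Q = M \<union> insert e Q\<close>.\<close>
      then show "find_matchings_dom (?call u v)" "?result u v = (\<union>) M ` insert {u, v} ` ?rest u v"
        by (simp_all add: image_image)
    qed
    let ?p = "first_degree_one V E" and ?c = "first_min_degree V E"
    have p: "?p \<in> V" "\<exists>q. neighbors E ?p = {q}"
      if "\<exists>u\<in>V. degree E u = 1"
    proof -
      have "?p \<in> {u \<in> V. degree E u = 1}"
        unfolding first_degree_one_def using fin that by (intro Min_in) auto
      then show "?p \<in> V" "\<exists>q. neighbors E ?p = {q}"
        by (simp_all add: degree_def card_1_singleton_iff)
    qed
    \<comment> \<open>A minimum-degree vertex exists because \<open>V\<close> is finite and
      nonempty, so \<open>Min\<close> is taken over a nonempty set.\<close>
    have "?c \<in> {u \<in> V. \<forall>w\<in>V. degree E u \<le> degree E w}"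
      unfolding first_min_degree_def
      using fin ex_is_arg_min_if_finite[OF fin \<open>V \<noteq> {}\<close>, of "degree E"]
      by (intro Min_in) (auto simp: is_arg_min_linorder)
    then have c: "?c \<in> V" by simp
    \<comment> \<open>The vertex \<open>u\<close> witnesses that the prune case applies; the call
      itself is made at \<open>?p\<close>, where \<open>the_elem\<close> yields the sole
      neighbor.\<close>
    have p_dom: "find_matchings_dom (?call ?p (the_elem (neighbors E ?p)))"
      if "\<not> (connected_graph V E \<and> card V = 2)" "u \<in> V" "degree E u = 1" for u
    proof -
      have ex: "\<exists>u\<in>V. degree E u = 1" using that(2,3) by blast
      obtain q where "neighbors E ?p = {q}" using p(2)[OF ex] ..
      with IH(1)[OF that(1) p(1)[OF ex], of q] show ?thesis by simp
    qed
    have dom: "find_matchings_dom (V, E, M)"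
      by (rule find_matchings.domintros) (use p_dom IH(1) c in simp_all)
    have result: "find_matchings V E M = (\<union>) M ` {P. perfect_matching V E P}"
    proof -
      consider (pair) "connected_graph V E \<and> card V = 2"
        | (prune) "\<not> (connected_graph V E \<and> card V = 2)" "\<exists>u\<in>V. degree E u = 1"
        | (odd) "\<not> (connected_graph V E \<and> card V = 2)" "\<not> (\<exists>u\<in>V. degree E u = 1)"
            "\<exists>C\<in>components V E. odd (card C)"
        | (choose) "\<not> (connected_graph V E \<and> card V = 2)" "\<not> (\<exists>u\<in>V. degree E u = 1)"
            "\<not> (\<exists>C\<in>components V E. odd (card C))"
        by blast
      then show ?thesis
      proof cases
        case pair
        then have "{P. perfect_matching V E P} = {{V}}"
          using perfect_matching_pair[OF graph] by auto
        then show ?thesis by (simp only: find_matchings.psimps[OF dom] pair) simp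
      next
        case prune
        obtain q where q: "neighbors E ?p = {q}" using p(2)[OF prune(2)] ..
        have "find_matchings V E M = ?result ?p q"
          by (simp only: find_matchings.psimps[OF dom] prune q the_elem_eq Let_def
              Un_insert_right Un_empty_right if_True if_False)
        also have "\<dots> = (\<union>) M ` insert {?p, q} ` ?rest ?p q"
          using IH(2)[OF prune(1) p(1)[OF prune(2)], of q] q by simp
        also have "insert {?p, q} ` ?rest ?p q = {P. perfect_matching V E P}"
          unfolding perfect_matchings_by_partner[OF graph p(1)[OF prune(2)]] q by simp
        finally show ?thesis .
      next
        case odd
        then have "{P. perfect_matching V E P} = {}"
          using even_component_of_perfect_matching[OF graph] by blast
        then show ?thesis
          by (simp only: find_matchings.psimps[OF dom] odd if_True if_False image_empty)
      next
        case choose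
        have "find_matchings V E M = (\<Union>v\<in>neighbors E ?c. ?result ?c v)"
          by (simp only: find_matchings.psimps[OF dom] choose Let_def Un_insert_right Un_empty_right if_True if_False)
        also have "\<dots> = (\<Union>v\<in>neighbors E ?c. (\<union>) M ` insert {?c, v} ` ?rest ?c v)"
          using IH(2)[OF choose(1) c] by simp
        also have "\<dots> = (\<union>) M ` {P. perfect_matching V E P}"
          unfolding perfect_matchings_by_partner[OF graph c] by (simp only: image_UN)
        finally show ?thesis .
      qed
    qed
    from dom result show ?case ..
  qed
  from this[of "{}"] show ?thesis by simp
qed

end
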